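(* Let $\delta\in(0,1/2)$. Assume that $M,N\colon G\to\mathbb C$ satisfy $\Psi_M\Psi_{N,N}\ne0$ and $\beta(M)\ge\beta(N)>0$. Consider the following conclusion. (C) For $\alpha\in\mathbb C$, the maximum of $\beta(M+\alpha N)$ occurs for $$\alpha=\alpha_1:=\frac{\overline{\Psi_M}\Psi_{M,N}-\overline{\Psi_N}\Psi_{M,M}}{\overline{\Psi_N}\,\overline{\Psi_{M,N}}-\overline{\Psi_M}\Psi_{N,N}}$$ and is $$\beta(M+\alpha_1N)=\frac{|\Psi_N|^2\Psi_{M,M}+|\Psi_M|^2\Psi_{N,N}-2\mathrm{Re}(\overline{\Psi_M}\Psi_N\Psi_{M,N})}{\Psi_{M,M}\Psi_{N,N}-|\Psi_{M,N}|^2}=\beta(M)+\frac{|\overline{\Psi_M}\Psi_{M,N}-\overline{\Psi_N}\Psi_{M,M}|^2}{\Psi_{M,M}(\Psi_{M,M}\Psi_{N,N}-|\Psi_{M,N}|^2)},$$ the denominators in these expressions for $\beta(M+\alpha_1N)$ being positive. Then the following hold. (i) Assume that $$|\overline{\Psi_M}\Psi_{M,N}-\overline{\Psi_N}\Psi_{M,M}|\ge\delta^2\,|\Psi_N|\Psi_{M,M}.$$ Then (C) holds, and furthermore $\beta(M+\alpha_1N)-\beta(M)\ge\delta^4\beta(N)$. (ii) Assume that $$|\overline{\Psi_M}\Psi_{M,N}-\overline{\Psi_N}\Psi_{M,M}|<\delta^2\,|\Psi_N|\Psi_{M,M}\quad\text{and}\quad|\Psi_N\Psi_{M,N}-\Psi_M\Psi_{N,N}|\ge\delta\,\Psi_{N,N}|\Psi_M|.$$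 Then (C) holds, and furthermore $$\beta(M+\alpha N)-\beta(M)\le\delta^2\frac{\beta(N)}{\beta(M)}\le\delta^2\quad\text{for every }\alpha\in\mathbb C.$$
   Context: $G$ is an (indexing) set, $L\colon G\to\mathbb C$ is a function, and $w\colon G\to[0,\infty)$ is a weight function, not identically $0$. For $f\colon G\to\mathbb C$ put $\mathbb E^w_{\pi\in G}f(\pi):=\frac{\sum_{\pi\in G}w(\pi)f(\pi)}{\sum_{\pi\in G}w(\pi)}$. For $M,N\colon G\to\mathbb C$ define $\Psi_M:=\mathbb E^w_{\pi\in G}L(\pi)M(\pi)$, $\Psi_{M,N}:=\mathbb E^w_{\pi\in G}L(\pi)M(\pi)\overline{L(\pi)N(\pi)}$, and $\beta(M):=|\Psi_M|^2/\Psi_{M,M}$ if $\Psi_{M,M}\ne0$, $\beta(M):=0$ if $\Psi_{M,M}=0$. It is assumed that the series $\sum_\pi w(\pi)$ and $\sum_\pi w(\pi)|L(\pi)M(\pi)|^2$ converge for every function $M$ considered (automatic if $G$ is finite). *)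

theory Defs
  imports "HOL-Analysis.Analysis"
begin

text \<open>Sums over the arbitrary index set \<open>G\<close> are unordered (unconditional) sums
  \<^const>\<open>infsum\<close>; they are \<open>0\<close> if not convergent, so convergence is always assumed explicitly.\<close>

definition wmean :: "'a set \<Rightarrow> ('a \<Rightarrow> real) \<Rightarrow> ('a \<Rightarrow> complex) \<Rightarrow> complex" where
  "wmean G w f =
     (\<Sum>\<^sub>\<infinity>\<pi>\<in>G. complex_of_real (w \<pi>) * f \<pi>) / complex_of_real (\<Sum>\<^sub>\<infinity>\<pi>\<in>G. w \<pi>)"

definition Psi :: "'a set \<Rightarrow> ('a \<Rightarrow> real) \<Rightarrow> ('a \<Rightarrow> complex) \<Rightarrow> ('a \<Rightarrow> complex) \<Rightarrow> complex" where
  "Psi G w L M = wmean G w (\<lambda>\<pi>. L \<pi> * M \<pi>)"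

definition Psi2 ::
  "'a set \<Rightarrow> ('a \<Rightarrow> real) \<Rightarrow> ('a \<Rightarrow> complex) \<Rightarrow> ('a \<Rightarrow> complex) \<Rightarrow> ('a \<Rightarrow> complex) \<Rightarrow> complex" where
  "Psi2 G w L M N = wmean G w (\<lambda>\<pi>. L \<pi> * M \<pi> * cnj (L \<pi> * N \<pi>))"

text \<open>The diagonal values of \<open>Psi2\<close> are real numbers.  Hence taking their real part, as is
  done below wherever they occur in a real-valued expression, loses nothing.\<close>

lemma Psi2_same_real: "complex_of_real (Re (Psi2 G w L M M)) = Psi2 G w L M M"
proof -
  have "cnj (Psi2 G w L M M) = Psi2 G w L M M"
    by (simp add: Psi2_def wmean_def mult_ac flip: infsum_cnj)
  thus ?thesis
    by (simp add: complex_eq_iff)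
qed

definition beta :: "'a set \<Rightarrow> ('a \<Rightarrow> real) \<Rightarrow> ('a \<Rightarrow> complex) \<Rightarrow> ('a \<Rightarrow> complex) \<Rightarrow> real" where
  "beta G w L M =
     (if Psi2 G w L M M \<noteq> 0 then (cmod (Psi G w L M))\<^sup>2 / Re (Psi2 G w L M M) else 0)"

definition alpha1_num ::
  "'a set \<Rightarrow> ('a \<Rightarrow> real) \<Rightarrow> ('a \<Rightarrow> complex) \<Rightarrow> ('a \<Rightarrow> complex) \<Rightarrow> ('a \<Rightarrow> complex) \<Rightarrow> complex" where
  "alpha1_num G w L M N =
     cnj (Psi G w L M) * Psi2 G w L M N - cnj (Psi G w L N) * Psi2 G w L M M"

definition alpha1_den ::
  "'a set \<Rightarrow> ('a \<Rightarrow> real) \<Rightarrow> ('a \<Rightarrow> complex) \<Rightarrow> ('a \<Rightarrow> complex) \<Rightarrow> ('a \<Rightarrow> complex) \<Rightarrow> complex" where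
  "alpha1_den G w L M N =
     cnj (Psi G w L N) * cnj (Psi2 G w L M N) - cnj (Psi G w L M) * Psi2 G w L N N"

definition alpha1 ::
  "'a set \<Rightarrow> ('a \<Rightarrow> real) \<Rightarrow> ('a \<Rightarrow> complex) \<Rightarrow> ('a \<Rightarrow> complex) \<Rightarrow> ('a \<Rightarrow> complex) \<Rightarrow> complex" where
  "alpha1 G w L M N = alpha1_num G w L M N / alpha1_den G w L M N"

definition beta_comb ::
  "'a set \<Rightarrow> ('a \<Rightarrow> real) \<Rightarrow> ('a \<Rightarrow> complex) \<Rightarrow> ('a \<Rightarrow> complex) \<Rightarrow> ('a \<Rightarrow> complex) \<Rightarrow> complex \<Rightarrow> real" where
  "beta_comb G w L M N \<alpha> = beta G w L (\<lambda>\<pi>. M \<pi> + \<alpha> * N \<pi>)"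

text \<open>The first conjunct says that \<open>alpha1\<close> is well defined; it is explicit because division
  by \<open>0\<close> is total in HOL.\<close>

definition max_at_alpha1 ::
  "'a set \<Rightarrow> ('a \<Rightarrow> real) \<Rightarrow> ('a \<Rightarrow> complex) \<Rightarrow> ('a \<Rightarrow> complex) \<Rightarrow> ('a \<Rightarrow> complex) \<Rightarrow> bool" where
  "max_at_alpha1 G w L M N \<longleftrightarrow>
     (let \<Psi>M = Psi G w L M; \<Psi>N = Psi G w L N;
          \<Psi>MM = Re (Psi2 G w L M M); \<Psi>NN = Re (Psi2 G w L N N); \<Psi>MN = Psi2 G w L M N;
          \<alpha>1 = alpha1 G w L M N;
          D = \<Psi>MM * \<Psi>NN - (cmod \<Psi>MN)\<^sup>2
      in alpha1_den G w L M N \<noteq> 0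
       \<and> (\<forall>\<alpha>. beta_comb G w L M N \<alpha> \<le> beta_comb G w L M N \<alpha>1)
       \<and> D > 0 \<and> \<Psi>MM * D > 0
       \<and> beta_comb G w L M N \<alpha>1 =
           ((cmod \<Psi>N)\<^sup>2 * \<Psi>MM + (cmod \<Psi>M)\<^sup>2 * \<Psi>NN - 2 * Re (cnj \<Psi>M * \<Psi>N * \<Psi>MN)) / D
       \<and> beta_comb G w L M N \<alpha>1 =
           beta G w L M + (cmod (cnj \<Psi>M * \<Psi>MN - cnj \<Psi>N * Psi2 G w L M M))\<^sup>2 / (\<Psi>MM * D))"

end

theory Submission
  imports Defs
begin

text \<open>Write \<open>m, n\<close> for \<open>\<Psi>\<^sub>M, \<Psi>\<^sub>N\<close> and \<open>A, B, C\<close> for \<open>\<Psi>\<^sub>M\<^sub>M, \<Psi>\<^sub>N\<^sub>N, \<Psi>\<^sub>M\<^sub>N\<close>.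
  Then \<open>\<beta>(M + \<alpha>N)\<close> is \<open>\<bar>m + \<alpha>n\<bar>\<^sup>2 / Q(\<alpha>)\<close> for a Hermitian form \<open>Q\<close>, and maximising it is a generalised
  Rayleigh quotient problem settled by one identity: with \<open>D = AB - \<bar>C\<bar>\<^sup>2\<close>, with \<open>S\<close> the numerator of
  the claimed maximum and with \<open>p, q\<close> the numerator and denominator of \<open>\<alpha>\<^sub>1\<close>,
  \<open>S Q(\<alpha>) - D \<bar>m + \<alpha>n\<bar>\<^sup>2 = \<bar>\<alpha>q - p\<bar>\<^sup>2\<close>.
  Nonnegativity of the variance gives \<open>\<bar>m + \<alpha>n\<bar>\<^sup>2 \<le> Q(\<alpha>)\<close>, so \<open>D = 0\<close> would force \<open>p = q = 0\<close>; thus \<open>D > 0\<close>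
  in both cases.  The bound in (i) is immediate from \<open>D \<le> AB\<close>.  In (ii) the two hypotheses locate
  \<open>m\<^sup>* n C\<close> in the complex plane precisely enough to give \<open>D \<ge> \<delta>\<^sup>2 AB\<close>, which yields the bound
  \<open>\<delta>\<^sup>2 \<beta>(N)\<close>, and \<open>\<beta>(M) \<le> 1\<close>.\<close>

section \<open>Scalar algebra and inequalities for the five numbers \<open>m\<close>,
  \<open>n\<close>, \<open>A\<close>, \<open>B\<close>, \<open>C\<close>\<close>

lemma rayleigh_identity:
  fixes m n C \<alpha> :: complex and A B :: real
  shows "((cmod n)\<^sup>2 * A + (cmod m)\<^sup>2 * B - 2 * Re (cnj m * n * C))
            * (A + 2 * Re (cnj \<alpha> * C) + (cmod \<alpha>)\<^sup>2 * B)
          - (A * B - (cmod C)\<^sup>2) * (cmod (m + \<alpha> * n))\<^sup>2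
        = (cmod (\<alpha> * (cnj n * cnj C - cnj m * B) - (cnj m * C - cnj n * A)))\<^sup>2"
proof -
  have re: "complex_of_real (2 * Re z) = z + cnj z" for z
    by (simp add: complex_add_cnj)
  have "complex_of_real (((cmod n)\<^sup>2 * A + (cmod m)\<^sup>2 * B - 2 * Re (cnj m * n * C))
            * (A + 2 * Re (cnj \<alpha> * C) + (cmod \<alpha>)\<^sup>2 * B)
          - (A * B - (cmod C)\<^sup>2) * (cmod (m + \<alpha> * n))\<^sup>2)
        = complex_of_real
            ((cmod (\<alpha> * (cnj n * cnj C - cnj m * B) - (cnj m * C - cnj n * A)))\<^sup>2)"
    \<comment> \<open>Over the complex numbers, squared moduli become \<open>z * cnj z\<close> and
      \<open>2 * Re z\<close> becomes \<open>z + cnj z\<close>, which leaves a polynomial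
      identity.\<close>
    unfolding of_real_add of_real_diff of_real_mult[of "_ + _"] of_real_mult[of "_ - _"] re
      complex_norm_square of_real_mult[of "(cmod _)\<^sup>2"] of_real_mult[of A]
    by (simp add: algebra_simps)
  thus ?thesis
    using of_real_eq_iff by blast
qed

text \<open>The right-hand side of \<open>le\<close> has minimum \<open>D / B\<close> with
  \<open>D = A * B - (cmod C)\<^sup>2\<close>. If \<open>D \<le> 0\<close>, equality holds at the
  minimiser with both sides 0, and the two expressions in \<open>ne\<close> vanish.\<close>

lemma gram_det_pos:
  fixes m n C :: complex and A B :: real
  assumes B: "B > 0"
    and le: "\<And>\<alpha>. (cmod (m + \<alpha> * n))\<^sup>2 \<le> A + 2 * Re (cnj \<alpha> * C) + (cmod \<alpha>)\<^sup>2 * B"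
    and ne: "cnj m * C - cnj n * A \<noteq> 0 \<or> n * C - m * B \<noteq> 0"
  shows "A * B - (cmod C)\<^sup>2 > 0"
proof (rule ccontr)
  assume neg: "\<not> A * B - (cmod C)\<^sup>2 > 0"
  \<comment> \<open>The minimiser, found by completing the square in
    \<open>\<alpha>\<close>.\<close>
  define \<alpha> where "\<alpha> = - C / B"
  have "cnj \<alpha> * C = complex_of_real (- (cmod C)\<^sup>2 / B)"
    unfolding of_real_divide of_real_minus complex_norm_square by (simp add: \<alpha>_def mult.commute)
  hence re: "Re (cnj \<alpha> * C) = - (cmod C)\<^sup>2 / B"
    by simp
  have Q: "A + 2 * Re (cnj \<alpha> * C) + (cmod \<alpha>)\<^sup>2 * B = (A * B - (cmod C)\<^sup>2) / B"
    unfolding re using B by (simp add: \<alpha>_def norm_divide field_simps power2_eq_square)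
  have *: "(cmod (m + \<alpha> * n))\<^sup>2 \<le> (A * B - (cmod C)\<^sup>2) / B"
    using le[of \<alpha>] Q by simp
  also have "\<dots> \<le> 0"
    using neg B by (simp add: divide_nonpos_pos)
  finally have "m + \<alpha> * n = 0"
    by simp
  hence m: "m * B = n * C"
    using B by (simp add: \<alpha>_def field_simps)
  have "0 \<le> (A * B - (cmod C)\<^sup>2) / B"
    using * zero_le_power2 order_trans by blast
  hence "A * B = (cmod C)\<^sup>2"
    using neg B by (simp add: zero_le_divide_iff)
  hence "complex_of_real A * B = C * cnj C"
    by (simp flip: complex_norm_square of_real_mult)
  moreover have "cnj m * B = cnj n * cnj C"
    using arg_cong[OF m, of cnj] by simp
  ultimately have "(cnj m * C - cnj n * A) * B = 0"
    by (simp add: algebra_simps)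
  hence "cnj m * C - cnj n * A = 0"
    using B by simp
  with m ne show False
    by simp
qed

text \<open>Eliminating \<open>Re W\<close> between the two hypotheses leaves an inequality in \<open>\<bar>W\<bar>\<^sup>2\<close> with the factor \<open>X - Y\<close>.\<close>

lemma cmod_sq_le_between_discs:
  fixes W :: complex and X Y \<delta> :: real
  assumes \<delta>: "0 < \<delta>" "\<delta> < 1" and Y: "0 < Y" "Y \<le> X"
    and near: "cmod (W - Y) \<le> \<delta>\<^sup>2 * Y" and far: "cmod (W - X) \<ge> \<delta> * X"
  shows "(cmod W)\<^sup>2 \<le> X * Y * (1 - \<delta>\<^sup>2)"
proof -
  have expand: "(cmod (W - complex_of_real r))\<^sup>2 = (cmod W)\<^sup>2 - 2 * r * Re W + r\<^sup>2" for r
    unfolding cmod_power2 by (simp add: power2_eq_square algebra_simps)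
  \<comment> \<open>This excludes \<open>X = Y\<close>, where \<open>W\<close> would be both within
    \<open>\<delta>\<^sup>2 * Y\<close> of \<open>Y\<close> and at least \<open>\<delta> * Y\<close>
    away from it.\<close>
  have "\<delta>\<^sup>2 < \<delta>"
    using \<delta> by (simp add: power2_eq_square)
  have XY: "Y < X"
  proof (rule ccontr)
    assume "\<not> Y < X"
    with Y have "Y = X"
      by simp
    with near far have "\<delta> * Y \<le> \<delta>\<^sup>2 * Y"
      by (metis order_trans)
    with \<open>\<delta>\<^sup>2 < \<delta>\<close> Y show False
      by simp
  qed
  have n: "(cmod W)\<^sup>2 - 2 * Y * Re W + Y\<^sup>2 \<le> \<delta> ^ 4 * Y\<^sup>2"
    using power_mono[OF near, of 2] by (simp add: expand power_mult_distrib flip: power_mult)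
  have f: "(cmod W)\<^sup>2 - 2 * X * Re W + X\<^sup>2 \<ge> \<delta>\<^sup>2 * X\<^sup>2"
    using power_mono[OF far, of 2] \<delta> Y by (simp add: expand power_mult_distrib)
  \<comment> \<open>\<open>X\<close> times \<open>n\<close> minus \<open>Y\<close> times
    \<open>f\<close> cancels \<open>Re W\<close>.\<close>
  have "(cmod W)\<^sup>2 * (X - Y) \<le> X * Y * (1 - \<delta>\<^sup>2) * (X - Y * (1 + \<delta>\<^sup>2))"
    using mult_left_mono[OF n, of X] mult_left_mono[OF f, of Y] Y
    by (simp add: algebra_simps power2_eq_square power4_eq_xxxx)
  also have "\<dots> \<le> X * Y * (1 - \<delta>\<^sup>2) * (X - Y)"
    using Y \<delta> by (intro mult_left_mono) (auto simp: algebra_simps power_le_one)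
  finally show ?thesis
    using XY by simp
qed

text \<open>Multiplying \<open>near\<close> by \<open>cmod n\<close> and \<open>far\<close> by
  \<open>cmod m\<close> turns both into distances from the single number
  \<open>W = cnj m * n * C\<close> to real points. The factor
  \<open>(cmod m)\<^sup>2 * (cmod n)\<^sup>2\<close>, common to \<open>(cmod W)\<^sup>2\<close> and
  \<open>X * Y\<close>, then cancels.\<close>

lemma gram_det_ge:
  fixes m n C :: complex and A B \<delta> :: real
  assumes \<delta>: "0 < \<delta>" "\<delta> < 1" and pos: "A > 0" "B > 0" and nz: "m \<noteq> 0" "n \<noteq> 0"
    and le: "(cmod n)\<^sup>2 * A \<le> (cmod m)\<^sup>2 * B"
    and near: "cmod (cnj m * C - cnj n * A) \<le> \<delta>\<^sup>2 * cmod n * A"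
    and far: "cmod (n * C - m * B) \<ge> \<delta> * B * cmod m"
  shows "A * B - (cmod C)\<^sup>2 \<ge> \<delta>\<^sup>2 * (A * B)"
proof -
  define W where "W = cnj m * n * C"
  define X where "X = (cmod m)\<^sup>2 * B"
  define Y where "Y = (cmod n)\<^sup>2 * A"
  have "W - Y = n * (cnj m * C - cnj n * A)"
    unfolding W_def Y_def of_real_mult complex_norm_square by (simp add: algebra_simps)
  hence "cmod (W - Y) \<le> \<delta>\<^sup>2 * Y"
    using mult_left_mono[OF near, of "cmod n"]
    by (simp add: norm_mult Y_def power2_eq_square mult_ac)
  moreover have "W - X = cnj m * (n * C - m * B)"
    unfolding W_def X_def of_real_mult complex_norm_square by (simp add: algebra_simps)
  hence "cmod (W - X) \<ge> \<delta> * X"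
    using mult_left_mono[OF far, of "cmod m"]
    by (simp add: norm_mult X_def power2_eq_square mult_ac)
  moreover have "0 < Y" "Y \<le> X"
    using nz pos le by (simp_all add: X_def Y_def)
  ultimately have "(cmod W)\<^sup>2 \<le> X * Y * (1 - \<delta>\<^sup>2)"
    using cmod_sq_le_between_discs \<delta> by blast
  hence "((cmod m)\<^sup>2 * (cmod n)\<^sup>2) * (cmod C)\<^sup>2
      \<le> ((cmod m)\<^sup>2 * (cmod n)\<^sup>2) * (A * B * (1 - \<delta>\<^sup>2))"
    by (simp add: W_def X_def Y_def norm_mult power_mult_distrib mult_ac)
  hence "(cmod C)\<^sup>2 \<le> A * B * (1 - \<delta>\<^sup>2)"
    using nz by simp
  thus ?thesis
    by (simp add: algebra_simps)
qed

section \<open>Convergence of the weighted series\<close>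

text \<open>Absolute convergence by the arithmetic-geometric mean inequality. It serves the cross
  terms and, with \<open>g = 1\<close>, the series for \<open>Psi\<close> itself.\<close>

lemma summable_on_weighted_mult:
  fixes w :: "'a \<Rightarrow> real" and f g :: "'a \<Rightarrow> complex"
  assumes "\<And>x. x \<in> G \<Longrightarrow> w x \<ge> 0"
    and "(\<lambda>x. w x * (cmod (f x))\<^sup>2) summable_on G"
    and "(\<lambda>x. w x * (cmod (g x))\<^sup>2) summable_on G"
  shows "(\<lambda>x. complex_of_real (w x) * (f x * cnj (g x))) summable_on G"
proof (rule Infinite_Sum.abs_summable_summable, rule Infinite_Sum.abs_summable_on_comparison_test')
  show "(\<lambda>x. w x * (cmod (f x))\<^sup>2 + w x * (cmod (g x))\<^sup>2) summable_on G"
    using assms by (intro summable_on_add)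
  fix x assume x: "x \<in> G"
  have "2 * (cmod (f x) * cmod (g x)) \<le> (cmod (f x))\<^sup>2 + (cmod (g x))\<^sup>2"
    using sum_squares_bound[of "cmod (f x)" "cmod (g x)"] by simp
  moreover have "0 \<le> cmod (f x) * cmod (g x)"
    by simp
  ultimately have "cmod (f x) * cmod (g x) \<le> (cmod (f x))\<^sup>2 + (cmod (g x))\<^sup>2"
    by linarith
  thus "norm (complex_of_real (w x) * (f x * cnj (g x)))
      \<le> w x * (cmod (f x))\<^sup>2 + w x * (cmod (g x))\<^sup>2"
    using mult_left_mono[of _ _ "w x"] assms(1)[OF x] by (simp add: norm_mult flip: distrib_left)
qed

text \<open>Carries the convergence assumed for \<open>M\<close> and \<open>N\<close> over to every
  combination \<open>M + \<alpha> N\<close>.\<close>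

lemma summable_on_weighted_cmod_add_sq:
  fixes w :: "'a \<Rightarrow> real" and f g :: "'a \<Rightarrow> complex"
  assumes w: "\<And>x. x \<in> G \<Longrightarrow> w x \<ge> 0"
    and f: "(\<lambda>x. w x * (cmod (f x))\<^sup>2) summable_on G"
    and g: "(\<lambda>x. w x * (cmod (g x))\<^sup>2) summable_on G"
  shows "(\<lambda>x. w x * (cmod (f x + g x))\<^sup>2) summable_on G"
proof (rule summable_on_comparison_test)
  show "(\<lambda>x. 2 * (w x * (cmod (f x))\<^sup>2 + w x * (cmod (g x))\<^sup>2)) summable_on G"
    by (intro summable_on_cmult_right summable_on_add f g)
  fix x assume x: "x \<in> G"
  have "(cmod (f x + g x))\<^sup>2 \<le> (cmod (f x) + cmod (g x))\<^sup>2"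
    by (intro power_mono norm_triangle_ineq) auto
  also have "\<dots> \<le> 2 * ((cmod (f x))\<^sup>2 + (cmod (g x))\<^sup>2)"
    using sum_squares_bound[of "cmod (f x)" "cmod (g x)"] by (simp add: power2_sum)
  finally show "w x * (cmod (f x + g x))\<^sup>2 \<le> 2 * (w x * (cmod (f x))\<^sup>2 + w x * (cmod (g x))\<^sup>2)"
    using mult_left_mono[of _ _ "w x"] w[OF x] by (fastforce simp: algebra_simps)
  show "0 \<le> w x * (cmod (f x + g x))\<^sup>2"
    using w[OF x] by simp
qed

section \<open>Linearity and positivity of the weighted mean\<close>

text \<open>Since \<open>Re\<close> undoes the embedding, both series converge together; otherwise
  both sums take the default value 0.\<close>

lemma infsum_complex_of_real: "(\<Sum>\<^sub>\<infinity>x\<in>G. complex_of_real (f x)) = complex_of_real (\<Sum>\<^sub>\<infinity>x\<in>G. f x)"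
proof (rule infsum_bounded_linear_strong)
  show "(\<lambda>x. complex_of_real (f x)) summable_on G \<longleftrightarrow> f summable_on G"
    using summable_on_bounded_linear[OF bounded_linear_Re, of "\<lambda>x. complex_of_real (f x)" G]
    by (auto intro: summable_on_of_real)
qed (rule bounded_linear_of_real)

lemma wmean_add:
  assumes "(\<lambda>x. complex_of_real (w x) * f x) summable_on G"
    and "(\<lambda>x. complex_of_real (w x) * g x) summable_on G"
  shows "wmean G w (\<lambda>x. f x + g x) = wmean G w f + wmean G w g"
  unfolding wmean_def using infsum_add[OF assms] by (simp add: distrib_left add_divide_distrib)

lemma wmean_cmult: "wmean G w (\<lambda>x. c * f x) = c * wmean G w f"
  unfolding wmean_def
  using infsum_cmult_right'[of c "\<lambda>x. complex_of_real (w x) * f x" G] by (simp add: mult_ac)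

lemma wmean_cnj: "wmean G w (\<lambda>x. cnj (f x)) = cnj (wmean G w f)"
  by (simp add: wmean_def flip: infsum_cnj)

lemma wmean_const:
  assumes "(\<Sum>\<^sub>\<infinity>x\<in>G. w x) \<noteq> 0"
  shows "wmean G w (\<lambda>x. c) = c"
proof -
  have "(\<Sum>\<^sub>\<infinity>x\<in>G. complex_of_real (w x) * c) = complex_of_real (\<Sum>\<^sub>\<infinity>x\<in>G. w x) * c"
    by (simp add: infsum_cmult_left' infsum_complex_of_real)
  thus ?thesis
    using assms by (simp add: wmean_def)
qed

lemma Re_wmean_cmod_sq_nonneg:
  assumes "\<And>x. x \<in> G \<Longrightarrow> w x \<ge> 0"
  shows "Re (wmean G w (\<lambda>x. f x * cnj (f x))) \<ge> 0"
proof -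
  have "wmean G w (\<lambda>x. f x * cnj (f x))
      = complex_of_real ((\<Sum>\<^sub>\<infinity>x\<in>G. w x * (cmod (f x))\<^sup>2) / (\<Sum>\<^sub>\<infinity>x\<in>G. w x))"
    unfolding wmean_def of_real_divide
    by (simp flip: complex_norm_square of_real_mult of_real_power add: infsum_complex_of_real)
  moreover have "(\<Sum>\<^sub>\<infinity>x\<in>G. w x * (cmod (f x))\<^sup>2) / (\<Sum>\<^sub>\<infinity>x\<in>G. w x) \<ge> 0"
    using assms by (intro divide_nonneg_nonneg infsum_nonneg) auto
  ultimately show ?thesis
    by simp
qed

lemma infsum_pos:
  fixes w :: "'a \<Rightarrow> real"
  assumes "\<And>x. x \<in> G \<Longrightarrow> w x \<ge> 0" "\<exists>x\<in>G. w x \<noteq> 0" "w summable_on G"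
  shows "(\<Sum>\<^sub>\<infinity>x\<in>G. w x) > 0"
proof -
  obtain y where y: "y \<in> G" "w y \<noteq> 0"
    using assms(2) by blast
  have "w y \<le> (\<Sum>\<^sub>\<infinity>x\<in>G. w x)"
    using finite_sum_le_infsum[of w G "{y}"] assms y by auto
  with y assms(1)[of y] show ?thesis
    by simp
qed

text \<open>Used twice: for the quadratic form \<open>Q\<close>, and with \<open>g = 1\<close> and
  \<open>\<alpha>\<close> minus the mean of \<open>f\<close> for the variance.\<close>

lemma wmean_linear_comb_mult_cnj:
  fixes f g :: "'a \<Rightarrow> complex"
  assumes w: "\<And>x. x \<in> G \<Longrightarrow> w x \<ge> 0"
    and f: "(\<lambda>x. w x * (cmod (f x))\<^sup>2) summable_on G"
    and g: "(\<lambda>x. w x * (cmod (g x))\<^sup>2) summable_on G"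
  shows "wmean G w (\<lambda>x. (f x + \<alpha> * g x) * cnj (f x + \<alpha> * g x))
    = wmean G w (\<lambda>x. f x * cnj (f x)) + complex_of_real (2 * Re (cnj \<alpha> * wmean G w (\<lambda>x. f x * cnj (g x))))
      + complex_of_real ((cmod \<alpha>)\<^sup>2) * wmean G w (\<lambda>x. g x * cnj (g x))"
proof -
  note s = summable_on_weighted_mult[where w = w and G = G, OF w]
  have sc: "(\<lambda>x. complex_of_real (w x) * (c * h x)) summable_on G"
    if "(\<lambda>x. complex_of_real (w x) * h x) summable_on G" for c and h :: "'a \<Rightarrow> complex"
    using summable_on_cmult_right[OF that, of c] by (simp add: mult_ac)
  have sa: "(\<lambda>x. complex_of_real (w x) * (h x + k x)) summable_on G"
    if "(\<lambda>x. complex_of_real (w x) * h x) summable_on G"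
      "(\<lambda>x. complex_of_real (w x) * k x) summable_on G" for h k :: "'a \<Rightarrow> complex"
    using summable_on_add[OF that] by (simp add: distrib_left)
  have "(\<lambda>x. (f x + \<alpha> * g x) * cnj (f x + \<alpha> * g x))
      = (\<lambda>x. f x * cnj (f x) + (cnj \<alpha> * (f x * cnj (g x)) + (\<alpha> * (g x * cnj (f x))
          + \<alpha> * cnj \<alpha> * (g x * cnj (g x)))))"
    by (simp add: algebra_simps)
  hence "wmean G w (\<lambda>x. (f x + \<alpha> * g x) * cnj (f x + \<alpha> * g x))
      = wmean G w (\<lambda>x. f x * cnj (f x)) + (cnj \<alpha> * wmean G w (\<lambda>x. f x * cnj (g x))
        + (\<alpha> * wmean G w (\<lambda>x. g x * cnj (f x)) + \<alpha> * cnj \<alpha> * wmean G w (\<lambda>x. g x * cnj (g x))))"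
    by (simp only: wmean_add wmean_cmult sa sc s f g)
  moreover have "wmean G w (\<lambda>x. g x * cnj (f x)) = cnj (wmean G w (\<lambda>x. f x * cnj (g x)))"
    by (simp add: mult.commute flip: wmean_cnj)
  ultimately show ?thesis
    unfolding complex_norm_square complex_add_cnj[symmetric] by simp
qed

lemma cmod_wmean_sq_le:
  fixes f :: "'a \<Rightarrow> complex"
  assumes w: "\<And>x. x \<in> G \<Longrightarrow> w x \<ge> 0" "\<exists>x\<in>G. w x \<noteq> 0" "w summable_on G"
    and f: "(\<lambda>x. w x * (cmod (f x))\<^sup>2) summable_on G"
  shows "(cmod (wmean G w f))\<^sup>2 \<le> Re (wmean G w (\<lambda>x. f x * cnj (f x)))"
proof -
  define \<mu> where "\<mu> = wmean G w f"
  have W: "(\<Sum>\<^sub>\<infinity>x\<in>G. w x) \<noteq> 0"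
    using infsum_pos[OF w] by simp
  \<comment> \<open>The variance of \<open>f\<close>, with \<open>\<mu>\<close> written as a
    multiple of the constant 1 to fit the expansion above.\<close>
  have "0 \<le> Re (wmean G w (\<lambda>x. (f x + - \<mu> * 1) * cnj (f x + - \<mu> * 1)))"
    by (intro Re_wmean_cmod_sq_nonneg w)
  also have "\<dots> = Re (wmean G w (\<lambda>x. f x * cnj (f x))) + 2 * Re (cnj (- \<mu>) * \<mu>) + (cmod \<mu>)\<^sup>2"
    using wmean_linear_comb_mult_cnj[of G w f "\<lambda>_. 1" "- \<mu>"] w f
    by (simp add: wmean_const[OF W] \<mu>_def)
  also have "cnj (- \<mu>) * \<mu> = - complex_of_real ((cmod \<mu>)\<^sup>2)"
    unfolding complex_norm_square by (simp add: mult.commute)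
  finally show ?thesis
    by (simp add: \<mu>_def)
qed

section \<open>Maximising \<open>beta\<close> over the combinations
  \<open>M + \<alpha> N\<close>\<close>

theorem corollary2p8:
  fixes G :: "'a set" and w :: "'a \<Rightarrow> real" and L M N :: "'a \<Rightarrow> complex" and \<delta> :: real
  assumes w_nonneg: "\<And>\<pi>. \<pi> \<in> G \<Longrightarrow> w \<pi> \<ge> 0"
    and w_nonzero: "\<exists>\<pi>\<in>G. w \<pi> \<noteq> 0"
    and w_summable: "w summable_on G"
    and M_summable: "(\<lambda>\<pi>. w \<pi> * (cmod (L \<pi> * M \<pi>))\<^sup>2) summable_on G"
    and N_summable: "(\<lambda>\<pi>. w \<pi> * (cmod (L \<pi> * N \<pi>))\<^sup>2) summable_on G"
    and delta: "0 < \<delta>" "\<delta> < 1 / 2"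
    and nonzero: "Psi G w L M * Psi2 G w L N N \<noteq> 0"
    and beta_MN: "beta G w L M \<ge> beta G w L N"
    and beta_N: "beta G w L N > 0"
  shows
    "(cmod (cnj (Psi G w L M) * Psi2 G w L M N - cnj (Psi G w L N) * Psi2 G w L M M)
          \<ge> \<delta>\<^sup>2 * cmod (Psi G w L N) * Re (Psi2 G w L M M)
      \<longrightarrow>
        max_at_alpha1 G w L M N
        \<and> beta_comb G w L M N (alpha1 G w L M N) - beta G w L M \<ge> \<delta> ^ 4 * beta G w L N)
   \<and> (cmod (cnj (Psi G w L M) * Psi2 G w L M N - cnj (Psi G w L N) * Psi2 G w L M M)
          < \<delta>\<^sup>2 * cmod (Psi G w L N) * Re (Psi2 G w L M M)
      \<and> cmod (Psi G w L N * Psi2 G w L M N - Psi G w L M * Psi2 G w L N N)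
          \<ge> \<delta> * Re (Psi2 G w L N N) * cmod (Psi G w L M)
      \<longrightarrow>
        max_at_alpha1 G w L M N
        \<and> (\<forall>\<alpha>. beta_comb G w L M N \<alpha> - beta G w L M
                 \<le> \<delta>\<^sup>2 * (beta G w L N / beta G w L M))
        \<and> \<delta>\<^sup>2 * (beta G w L N / beta G w L M) \<le> \<delta>\<^sup>2)"
proof -
  define m where "m = Psi G w L M"
  define n where "n = Psi G w L N"
  define A where "A = Re (Psi2 G w L M M)"
  define B where "B = Re (Psi2 G w L N N)"
  define C where "C = Psi2 G w L M N"
  define D where "D = A * B - (cmod C)\<^sup>2"
  define Q where "Q = (\<lambda>\<alpha>. A + 2 * Re (cnj \<alpha> * C) + (cmod \<alpha>)\<^sup>2 * B)"
  define p where "p = cnj m * C - cnj n * A"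
  define q where "q = cnj n * cnj C - cnj m * B"
  define S where "S = (cmod n)\<^sup>2 * A + (cmod m)\<^sup>2 * B - 2 * Re (cnj m * n * C)"
  have A': "Psi2 G w L M M = of_real A" and B': "Psi2 G w L N N = of_real B"
    by (simp_all add: A_def B_def Psi2_same_real)
  have p': "cnj (Psi G w L M) * Psi2 G w L M N - cnj (Psi G w L N) * Psi2 G w L M M = p"
    by (simp add: p_def m_def n_def C_def A')
  have q': "alpha1_den G w L M N = q"
    by (simp add: alpha1_den_def q_def m_def n_def C_def B')
  have \<alpha>1: "alpha1 G w L M N = p / q"
    by (simp add: alpha1_def alpha1_num_def p' q')
  have cmod_q: "cmod (Psi G w L N * Psi2 G w L M N - Psi G w L M * Psi2 G w L N N) = cmod q"
  proof -
    have "q = cnj (n * C - m * B)"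
      by (simp add: q_def)
    thus ?thesis
      by (simp only: complex_mod_cnj m_def n_def C_def B')
  qed

  have s: "(\<lambda>x. complex_of_real (w x) * (f x * cnj (g x))) summable_on G"
    if "(\<lambda>x. w x * (cmod (f x))\<^sup>2) summable_on G" "(\<lambda>x. w x * (cmod (g x))\<^sup>2) summable_on G" for f g
    using summable_on_weighted_mult[OF _ that] w_nonneg by blast
  have comb: "L x * (M x + \<alpha> * N x) = L x * M x + \<alpha> * (L x * N x)" for x \<alpha>
    by (simp add: algebra_simps)
  have s1: "(\<lambda>x. w x * (cmod (1::complex))\<^sup>2) summable_on G"
    using w_summable by simp
  have sM: "(\<lambda>x. complex_of_real (w x) * (L x * M x)) summable_on G"
    using s[OF M_summable s1] by simp
  have sN: "(\<lambda>x. complex_of_real (w x) * (\<alpha> * (L x * N x))) summable_on G" for \<alpha>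
    using summable_on_cmult_right[OF s[OF N_summable s1], of \<alpha>] by (simp add: mult_ac)
  have Psi_comb: "Psi G w L (\<lambda>x. M x + \<alpha> * N x) = m + \<alpha> * n" for \<alpha>
    unfolding Psi_def comb m_def n_def wmean_add[OF sM sN] wmean_cmult ..
  have Psi2_comb: "Psi2 G w L (\<lambda>x. M x + \<alpha> * N x) (\<lambda>x. M x + \<alpha> * N x) = of_real (Q \<alpha>)" for \<alpha>
    using wmean_linear_comb_mult_cnj[OF _ M_summable N_summable, of \<alpha>] w_nonneg A' B'
    unfolding Psi2_def comb Q_def C_def by simp
  have le_Q: "(cmod (m + \<alpha> * n))\<^sup>2 \<le> Q \<alpha>" for \<alpha>
  proof -
    have "(\<lambda>x. w x * (cmod (\<alpha> * (L x * N x)))\<^sup>2) summable_on G"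
      using summable_on_cmult_right[OF N_summable, of "(cmod \<alpha>)\<^sup>2"]
      by (simp add: norm_mult power_mult_distrib mult_ac)
    hence "(\<lambda>x. w x * (cmod (L x * (M x + \<alpha> * N x)))\<^sup>2) summable_on G"
      unfolding comb using w_nonneg M_summable by (intro summable_on_weighted_cmod_add_sq)
    from cmod_wmean_sq_le[OF _ w_nonzero w_summable this] show ?thesis
      using w_nonneg Psi_comb[of \<alpha>] Psi2_comb[of \<alpha>] unfolding Psi_def Psi2_def by simp
  qed
  \<comment> \<open>Also true when \<open>Q \<alpha> = 0\<close>: division by 0 yields 0, the value
    \<open>beta\<close> prescribes there.\<close>
  have beta_comb: "beta_comb G w L M N \<alpha> = (cmod (m + \<alpha> * n))\<^sup>2 / Q \<alpha>" for \<alpha>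
    by (simp add: beta_comb_def beta_def Psi_comb Psi2_comb)
  have beta_M: "beta G w L M = (cmod m)\<^sup>2 / A" and beta_N': "beta G w L N = (cmod n)\<^sup>2 / B"
    by (simp_all add: beta_def A' B' m_def n_def)

  have "m \<noteq> 0"
    using nonzero by (simp add: m_def)
  have "n \<noteq> 0" "B > 0"
    using beta_N unfolding beta_N' by (auto simp: zero_less_divide_iff)
  \<comment> \<open>Otherwise the quotient for \<open>beta G w L M\<close> would be at most 0, below
    \<open>beta G w L N\<close>.\<close>
  have "A > 0"
    using beta_N beta_MN unfolding beta_M
    by (smt (verit) divide_nonneg_nonpos zero_le_power2)
  have mono: "(cmod n)\<^sup>2 * A \<le> (cmod m)\<^sup>2 * B"
    using beta_MN \<open>A > 0\<close> \<open>B > 0\<close> unfolding beta_M beta_N' by (simp add: field_simps)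
  have ident: "S * Q \<alpha> - D * (cmod (m + \<alpha> * n))\<^sup>2 = (cmod (\<alpha> * q - p))\<^sup>2" for \<alpha>
    unfolding S_def Q_def D_def p_def q_def by (rule rayleigh_identity)
  \<comment> \<open>This amounts to \<open>beta G w L M \<le> 1\<close>, the source of the last
    estimate in (ii).\<close>
  have "(cmod m)\<^sup>2 \<le> A"
    using le_Q[of 0] by (simp add: Q_def)

  have D_pos: "D > 0" if "p \<noteq> 0 \<or> q \<noteq> 0"
  proof -
    have "q = cnj (n * C - m * B)"
      by (simp add: q_def)
    hence "cnj m * C - cnj n * A \<noteq> 0 \<or> n * C - m * B \<noteq> 0"
      using that p_def by (metis complex_cnj_zero)
    from gram_det_pos[OF \<open>B > 0\<close> _ this] show ?thesis
      using le_Q unfolding Q_def D_def by blast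
  qed

  \<comment> \<open>At \<open>\<alpha> = 0\<close> the identity reads
    \<open>S * A - D * (cmod m)\<^sup>2 = (cmod p)\<^sup>2\<close>; divide by
    \<open>A * D\<close>.\<close>
  have S_eq: "S / D = (cmod m)\<^sup>2 / A + (cmod p)\<^sup>2 / (A * D)" if "D > 0"
    using ident[of 0] that \<open>A > 0\<close> by (simp add: Q_def field_simps)
  have le_max: "beta_comb G w L M N \<alpha> \<le> S / D"
    and q_nz: "q \<noteq> 0"
    and at_max: "beta_comb G w L M N (p / q) = S / D" if "D > 0" for \<alpha>
  proof -
    have Q_pos: "Q \<alpha> > 0" for \<alpha>
    proof -
      \<comment> \<open>Completing the square shows that \<open>D > 0\<close> makes \<open>Q\<close>
        positive everywhere.\<close>
      have "(cmod (complex_of_real B * \<alpha> + C))\<^sup>2 + D = B * Q \<alpha>"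
        unfolding Q_def D_def cmod_power2 by (simp add: algebra_simps power2_eq_square)
      hence "0 < B * Q \<alpha>"
        using that by (metis add_nonneg_pos zero_le_power2)
      with \<open>B > 0\<close> show ?thesis
        by (simp add: zero_less_mult_iff)
    qed
    show "beta_comb G w L M N \<alpha> \<le> S / D"
    proof -
      have "D * (cmod (m + \<alpha> * n))\<^sup>2 \<le> S * Q \<alpha>"
        using ident[of \<alpha>] by (metis diff_ge_0_iff_ge zero_le_power2)
      thus ?thesis
        unfolding beta_comb using Q_pos[of \<alpha>] that by (simp add: field_simps)
    qed
    \<comment> \<open>If \<open>q = 0\<close>, then \<open>beta(M) \<ge> beta(N)\<close> in the form
      \<open>mono\<close> forces \<open>(cmod C)\<^sup>2 \<ge> A * B\<close>, against
      \<open>D > 0\<close>.\<close>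
    show "q \<noteq> 0"
    proof
      assume "q = 0"
      hence "cmod (cnj n * cnj C) = cmod (cnj m * B)"
        by (simp add: q_def)
      hence "cmod n * cmod C = cmod m * B"
        using \<open>B > 0\<close> by (simp add: norm_mult)
      hence "(cmod n)\<^sup>2 * (cmod C)\<^sup>2 = (cmod m)\<^sup>2 * B * B"
        by (metis power_mult_distrib power2_eq_square mult.assoc)
      also have "\<dots> \<ge> (cmod n)\<^sup>2 * A * B"
        using mono \<open>B > 0\<close> by simp
      finally have "(cmod n)\<^sup>2 * (A * B) \<le> (cmod n)\<^sup>2 * (cmod C)\<^sup>2"
        by (simp add: mult_ac)
      with \<open>n \<noteq> 0\<close> that show False
        by (simp add: D_def)
    qed
    \<comment> \<open>The square on the right of \<open>ident\<close> vanishes exactly at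
      \<open>p / q\<close>.\<close>
    thus "beta_comb G w L M N (p / q) = S / D"
      using ident[of "p / q"] Q_pos[of "p / q"] that unfolding beta_comb by (simp add: field_simps)
  qed
  have conclusion_C: "max_at_alpha1 G w L M N" if "D > 0"
    unfolding max_at_alpha1_def Let_def p' q' \<alpha>1
    using le_max[OF that] q_nz[OF that] at_max[OF that] S_eq[OF that] that \<open>A > 0\<close>
    by (simp add: beta_M S_def D_def A_def B_def C_def m_def n_def)
  have gain: "S / D - beta G w L M = (cmod p)\<^sup>2 / (A * D)" if "D > 0"
    using S_eq[OF that] by (simp add: beta_M)

  show ?thesis
    unfolding p' cmod_q
    unfolding \<alpha>1
    unfolding m_def[symmetric] n_def[symmetric] A_def[symmetric] B_def[symmetric]
  proof (intro conjI impI allI; (elim conjE)?)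
    assume big: "\<delta>\<^sup>2 * cmod n * A \<le> cmod p"
    moreover have "0 < \<delta>\<^sup>2 * cmod n * A"
      using delta \<open>n \<noteq> 0\<close> \<open>A > 0\<close> by simp
    ultimately have "p \<noteq> 0"
      by auto
    hence "D > 0"
      using D_pos by blast
    thus "max_at_alpha1 G w L M N"
      by (rule conclusion_C)
    have "(\<delta>\<^sup>2 * cmod n * A)\<^sup>2 \<le> (cmod p)\<^sup>2"
      using big \<open>A > 0\<close> by (intro power_mono) auto
    moreover have "A * D \<le> A * (A * B)"
      using \<open>A > 0\<close> by (simp add: D_def)
    ultimately have "(\<delta>\<^sup>2 * cmod n * A)\<^sup>2 / (A * (A * B)) \<le> (cmod p)\<^sup>2 / (A * D)"
      using \<open>D > 0\<close> \<open>A > 0\<close> by (intro frac_le) auto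
    also have "(\<delta>\<^sup>2 * cmod n * A)\<^sup>2 / (A * (A * B)) = \<delta> ^ 4 * beta G w L N"
      using \<open>A > 0\<close> by (simp add: beta_N' power2_eq_square power4_eq_xxxx)
    finally show "\<delta> ^ 4 * beta G w L N \<le> beta_comb G w L M N (p / q) - beta G w L M"
      using gain at_max \<open>D > 0\<close> by simp
  next
    have \<beta>_le: "beta G w L M \<le> 1"
      using \<open>A > 0\<close> \<open>(cmod m)\<^sup>2 \<le> A\<close> by (simp add: beta_M)
    have \<beta>_pos: "beta G w L M > 0"
      using beta_N beta_MN by linarith
    have "beta G w L N / beta G w L M \<le> 1"
      using beta_MN \<beta>_pos by simp
    thus "\<delta>\<^sup>2 * (beta G w L N / beta G w L M) \<le> \<delta>\<^sup>2"
      using mult_left_le zero_le_power2 by blast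
    assume small: "cmod p < \<delta>\<^sup>2 * cmod n * A" and far: "\<delta> * B * cmod m \<le> cmod q"
    have "cmod q = cmod (n * C - m * B)"
      using cmod_q by (simp add: m_def n_def C_def B')
    hence D_ge: "D \<ge> \<delta>\<^sup>2 * (A * B)"
      unfolding D_def using small far delta \<open>A > 0\<close> \<open>B > 0\<close> \<open>m \<noteq> 0\<close> \<open>n \<noteq> 0\<close> mono
      by (intro gram_det_ge[of \<delta> A B m n C]) (auto simp: p_def)
    moreover have AB: "\<delta>\<^sup>2 * (A * B) > 0"
      using delta \<open>A > 0\<close> \<open>B > 0\<close> by simp
    ultimately have "D > 0"
      by linarith
    thus "max_at_alpha1 G w L M N"
      by (rule conclusion_C)
    fix \<alpha>
    \<comment> \<open>No \<open>\<alpha>\<close> gains more than the maximum does. There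
      \<open>small\<close> contributes \<open>\<delta>\<close> to the fourth power and the lower
      bound on \<open>D\<close> costs \<open>\<delta>\<^sup>2\<close>.\<close>
    have "beta_comb G w L M N \<alpha> - beta G w L M \<le> (cmod p)\<^sup>2 / (A * D)"
      using gain le_max[of \<alpha>] \<open>D > 0\<close> by simp
    also have "\<dots> \<le> (\<delta>\<^sup>2 * cmod n * A)\<^sup>2 / (A * (\<delta>\<^sup>2 * (A * B)))"
      using small D_ge AB \<open>A > 0\<close> by (intro frac_le power_mono mult_left_mono) auto
    also have "\<dots> = \<delta>\<^sup>2 * beta G w L N"
      using \<open>A > 0\<close> delta by (simp add: beta_N' power2_eq_square)
    \<comment> \<open>Dividing by \<open>beta G w L M \<le> 1\<close> can only increase the
      bound.\<close>
    also have "\<dots> \<le> \<delta>\<^sup>2 * (beta G w L N / beta G w L M)"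
      using \<beta>_le \<beta>_pos beta_N by (intro mult_left_mono) (auto simp: field_simps)
    finally show "beta_comb G w L M N \<alpha> - beta G w L M
        \<le> \<delta>\<^sup>2 * (beta G w L N / beta G w L M)" .
  qed
qed

end
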